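(* Let $G$ be a connected cograph on $n$ vertices with cotree $T_G$ having $r$ interior vertices $w_1,\dots,w_r$, where $w_1$ is the root of $T_G$. For each $i$, let $s_i$ be the number of children of $w_i$ that are interior vertices and $t_i$ the number of children of $w_i$ that are leaves. Then the number of spanning trees of $G$ equals $$\prod_{i=2}^{r}\delta(w_i)^{\,s_i+t_i-1}\cdot n^{\,s_1+t_1-2},$$ where $\delta(w_i)$ is the degree of the interior vertex $w_i$.
   Context: A cograph is a graph with no induced path on four vertices. The cotree $T_G$ of a cograph $G$ is the rooted tree whose leaves are the vertices of $G$, whose interior vertices are each labelled $\cup$ or $\otimes$, every interior vertex having at least two children, with labels alternating along every root-to-leaf path (root of type $\otimes$ when $G$ is connected), and such that two vertices of $G$ are adjacent iff their least common ancestor in $T_G$ is of $\otimes$-type. For interior vertices $w_i,w_j$, $lca(w_i,w_j)$ denotes their least common ancestor (with $lca(w_j,w_j)=w_j$). The degree of an interior vertex $w_j$ is $\delta(w_j)=$ the number of leaves $v$ of $T_G$ whose parent $w_i$ satisfies that $lca(w_i,w_j)$ is of $\otimes$-type. A spanning tree of a connected graph on $n$ vertices is a connected subgraph with all $n$ vertices and $n-1$ edges. *)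

theory Defs
  imports Main
begin

text \<open>Simple graphs are given by a vertex set and a set of two-element edges.\<close>

definition simple_graph :: "'a set \<Rightarrow> 'a set set \<Rightarrow> bool" where
  "simple_graph V E \<longleftrightarrow> finite V \<and> (\<forall>e\<in>E. e \<subseteq> V \<and> card e = 2)"

definition connected_graph :: "'a set \<Rightarrow> 'a set set \<Rightarrow> bool" where
  "connected_graph V E \<longleftrightarrow> V \<noteq> {} \<and> (\<forall>u\<in>V. \<forall>v\<in>V. (u, v) \<in> {(x, y). {x, y} \<in> E}\<^sup>*)"

definition cograph :: "'a set \<Rightarrow> 'a set set \<Rightarrow> bool" where
  "cograph V E \<longleftrightarrow> simple_graph V E \<and>
     \<not> (\<exists>a\<in>V. \<exists>b\<in>V. \<exists>c\<in>V. \<exists>d\<in>V. distinct [a, b, c, d] \<and>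
          {a, b} \<in> E \<and> {b, c} \<in> E \<and> {c, d} \<in> E \<and>
          {a, c} \<notin> E \<and> {b, d} \<notin> E \<and> {a, d} \<notin> E)"

text \<open>A spanning subgraph contains all vertices, so it is determined by its edge set.\<close>

definition spanning_trees :: "'a set \<Rightarrow> 'a set set \<Rightarrow> 'a set set set" where
  "spanning_trees V E = {F. F \<subseteq> E \<and> connected_graph V F \<and> card F = card V - 1}"

datatype cotree_label = UnionNode | JoinNode

text \<open>The values of \<open>tparent\<close> at the root and of \<open>tlabel\<close> at the leaves carry no information.\<close>

record 'a cotree =
  tnodes :: "'a set"
  troot :: 'a
  tparent :: "'a \<Rightarrow> 'a"
  tlabel :: "'a \<Rightarrow> cotree_label"

definition parent_rel :: "'a cotree \<Rightarrow> ('a \<times> 'a) set" where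
  "parent_rel T = {(x, tparent T x) | x. x \<in> tnodes T - {troot T}}"

definition rooted_tree :: "'a cotree \<Rightarrow> bool" where
  "rooted_tree T \<longleftrightarrow> finite (tnodes T) \<and> troot T \<in> tnodes T \<and>
     parent_rel T \<subseteq> tnodes T \<times> tnodes T \<and>
     (\<forall>x\<in>tnodes T. (x, troot T) \<in> (parent_rel T)\<^sup>*)"

definition tree_children :: "'a cotree \<Rightarrow> 'a \<Rightarrow> 'a set" where
  "tree_children T w = {x. (x, w) \<in> parent_rel T}"

definition tree_leaves :: "'a cotree \<Rightarrow> 'a set" where
  "tree_leaves T = {x \<in> tnodes T. tree_children T x = {}}"

definition interior_nodes :: "'a cotree \<Rightarrow> 'a set" where
  "interior_nodes T = tnodes T - tree_leaves T"

definition is_ancestor :: "'a cotree \<Rightarrow> 'a \<Rightarrow> 'a \<Rightarrow> bool" where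
  "is_ancestor T a x \<longleftrightarrow> (x, a) \<in> (parent_rel T)\<^sup>*"

definition lca :: "'a cotree \<Rightarrow> 'a \<Rightarrow> 'a \<Rightarrow> 'a" where
  "lca T x y = (THE z. is_ancestor T z x \<and> is_ancestor T z y \<and>
     (\<forall>a. is_ancestor T a x \<and> is_ancestor T a y \<longrightarrow> is_ancestor T a z))"

definition is_cotree_of :: "'a cotree \<Rightarrow> 'a set \<Rightarrow> 'a set set \<Rightarrow> bool" where
  "is_cotree_of T V E \<longleftrightarrow> rooted_tree T \<and> tree_leaves T = V \<and>
     (\<forall>w\<in>interior_nodes T. 2 \<le> card (tree_children T w)) \<and>
     (\<forall>w\<in>interior_nodes T. \<forall>c\<in>tree_children T w \<inter> interior_nodes T. tlabel T c \<noteq> tlabel T w) \<and>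
     (connected_graph V E \<and> troot T \<in> interior_nodes T \<longrightarrow> tlabel T (troot T) = JoinNode) \<and>
     (\<forall>u\<in>V. \<forall>v\<in>V. u \<noteq> v \<longrightarrow> ({u, v} \<in> E \<longleftrightarrow> tlabel T (lca T u v) = JoinNode))"

definition interior_degree :: "'a cotree \<Rightarrow> 'a \<Rightarrow> nat" where
  "interior_degree T w = card {v \<in> tree_leaves T. tlabel T (lca T (tparent T v) w) = JoinNode}"

definition num_interior_children :: "'a cotree \<Rightarrow> 'a \<Rightarrow> nat" where
  "num_interior_children T w = card (tree_children T w \<inter> interior_nodes T)"

definition num_leaf_children :: "'a cotree \<Rightarrow> 'a \<Rightarrow> nat" where
  "num_leaf_children T w = card (tree_children T w \<inter> tree_leaves T)"

end

theory Submission
  imports Defs "HOL-Computational_Algebra.Polynomial"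
begin

text \<open>
  A rooted spanning forest of \<open>V\<close> is encoded by its parent map \<open>f\<close>, with \<open>f v = None\<close> at the roots.
  Give each vertex \<open>v\<close> a \<^emph>\<open>row\<close> \<open>r v\<close> of weights for its possible values \<open>f v\<close>, and let \<open>forest_sum V r\<close>
  be the total weight of all forests. If \<open>u\<close> and \<open>v\<close> have the same row with total \<open>Q\<close>, then the sum is
  \<open>Q\<close> times the sum in which \<open>u\<close> is forced to point to \<open>v\<close>. Moreover, an entry of a row may be changed
  freely if using it would close a cycle with forced arcs.

  Start with the adjacency rows, a root having weight \<open>X\<close>, and work up the cotree. Once the leaves
  below each child of \<open>w\<close> are forced towards one representative, the rows of the representatives
  can be made equal, with total \<open>X + \<delta>(w)\<close>, so that \<open>w\<close> contributes
  \<open>(X + \<delta>(w)) ^ (s + t - 1)\<close>. At the root of the cotree only the factor \<open>X\<close> remains.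
  The coefficient of \<open>X\<close> counts the spanning trees with a distinguished root, i.e. each spanning
  tree \<open>n\<close> times, and \<open>\<delta>(w\<^sub>1) = n\<close>.
\<close>

section \<open>Weighted sums over rooted forests\<close>

definition forests :: "'a set \<Rightarrow> ('a \<rightharpoonup> 'a) set" where
  "forests S = {f. dom f \<subseteq> S \<and> ran f \<subseteq> S \<and> acyclic (Map.graph f)}"

text \<open>Values lie in a semiring so that polynomials over \<open>nat\<close> can be used; the
  arguments below factor and regroup sums without subtracting.\<close>

definition forest_sum :: "'a set \<Rightarrow> ('a \<Rightarrow> 'a option \<Rightarrow> 'b::comm_semiring_1) \<Rightarrow> 'b" where
  "forest_sum S r = (\<Sum>f\<in>forests S. \<Prod>v\<in>S. r v (f v))"

definition targets :: "'a set \<Rightarrow> 'a option set" where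
  "targets S = insert None (Some ` S)"

definition forced :: "'a \<Rightarrow> 'a option \<Rightarrow> 'b::comm_semiring_1" where
  "forced v y = (if y = Some v then 1 else 0)"

lemma finite_targets: "finite S \<Longrightarrow> finite (targets S)"
  by (simp add: targets_def)

lemma forest_value: "f \<in> forests S \<Longrightarrow> f x \<in> targets S"
  by (cases "f x") (auto simp: forests_def targets_def ran_def)

lemma finite_forests:
  assumes "finite S"
  shows "finite (forests S)"
proof (rule finite_subset)
  show "forests S \<subseteq> (\<Union>A\<in>Pow S. {m. dom m = A \<and> ran m \<subseteq> S})"
    by (auto simp: forests_def)
  show "finite (\<Union>A\<in>Pow S. {m. dom m = A \<and> ran m \<subseteq> S})"
    using assms by (auto intro!: finite_set_of_finite_maps dest: finite_subset)
qed

lemma single_valued_graph: "single_valued (Map.graph f)"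
  by (auto simp: single_valued_def Map.graph_def)

text \<open>A cycle through a vertex also passes through its only successor. The sink lies on no
  cycle, so neither does any vertex leading to it.\<close>

lemma acyclic_if_reaches_sink:
  assumes "single_valued R" "z \<notin> Domain R" "\<And>x. x \<in> Domain R \<Longrightarrow> (x, z) \<in> R\<^sup>*"
  shows "acyclic R"
proof (unfold acyclic_def, intro allI notI)
  fix x assume cyc: "(x, x) \<in> R\<^sup>+"
  hence "(x, z) \<in> R\<^sup>*" using assms(3) by (metis Domain.DomainI tranclD)
  hence "(x, x) \<notin> R\<^sup>+"
  proof (induction rule: converse_rtrancl_induct)
    case base
    show ?case using assms(2) by (metis Domain.DomainI tranclD)
  next
    case (step x y)
    show ?case
    proof
      assume "(x, x) \<in> R\<^sup>+"
      then obtain y' where "(x, y') \<in> R" "(y', x) \<in> R\<^sup>*" by (meson tranclD)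
      with step assms(1) have "(y, x) \<in> R\<^sup>*" by (metis single_valuedD)
      with step show False by (meson rtrancl_into_trancl1)
    qed
  qed
  with cyc show False by simp
qed

lemma forest_reaches_root:
  assumes "finite S" "f \<in> forests S" "x \<in> S"
  shows "\<exists>z\<in>S. f z = None \<and> (x, z) \<in> (Map.graph f)\<^sup>*"
proof -
  have sub: "Map.graph f \<subseteq> S \<times> S"
    using assms(2) by (auto simp: forests_def Map.graph_def ran_def dom_def)
  hence "finite (Map.graph f)" using assms(1) by (meson finite_SigmaI finite_subset)
  hence "wf ((Map.graph f)\<inverse>)"
    using assms(2) by (auto intro: finite_acyclic_wf_converse simp: forests_def)
  thus ?thesis using assms(3)
  proof (induction x rule: wf_induct_rule)
    case (less x)
    show ?case
    proof (cases "f x")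
      case (Some y)
      hence "(x, y) \<in> Map.graph f" by (simp add: in_graphI)
      moreover from this have "\<exists>z\<in>S. f z = None \<and> (y, z) \<in> (Map.graph f)\<^sup>*"
        using less.IH[of y] sub by blast
      ultimately show ?thesis by (meson converse_rtrancl_into_rtrancl)
    qed (use less in auto)
  qed
qed

section \<open>Vertices with equal rows\<close>

definition linking_pairs :: "'a set \<Rightarrow> 'a \<Rightarrow> 'a \<Rightarrow> ('a \<rightharpoonup> 'a) \<Rightarrow> ('a option \<times> 'a option) set" where
  "linking_pairs S u v g =
     {(\<alpha>, \<beta>). \<alpha> \<in> targets S \<and> \<beta> \<in> targets S \<and> acyclic (Map.graph (g(u := \<alpha>, v := \<beta>)))}"

lemma acyclic_graph_upd:
  assumes "g u = None"
  shows "acyclic (Map.graph (g(u := \<alpha>))) \<longleftrightarrow>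
    acyclic (Map.graph g) \<and> (\<forall>a. \<alpha> = Some a \<longrightarrow> (a, u) \<notin> (Map.graph g)\<^sup>*)"
  using assms by (cases \<alpha>) (auto simp: fun_upd_idem acyclic_insert)

text \<open>Deleting the values at \<open>u\<close> and \<open>v\<close> turns a forest into some
  \<open>g\<close> in which both are roots; the deleted pair can be any pair closing no cycle. The
  weights of the other vertices depend on \<open>g\<close> alone.\<close>

lemma forest_sum_split:
  fixes r :: "'a \<Rightarrow> 'a option \<Rightarrow> 'b::comm_semiring_1"
  assumes "finite S" "u \<in> S" "v \<in> S" "u \<noteq> v"
  shows "forest_sum S r = (\<Sum>g\<in>{g \<in> forests S. g u = None \<and> g v = None}.
    (\<Prod>x\<in>S - {u, v}. r x (g x)) * (\<Sum>(\<alpha>, \<beta>)\<in>linking_pairs S u v g. r u \<alpha> * r v \<beta>))"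
    (is "_ = (\<Sum>g\<in>?G. ?P g * _)")
proof -
  have finG: "finite ?G" using finite_forests[OF assms(1)] by simp
  have finL: "finite (linking_pairs S u v g)" for g
    by (rule finite_subset[of _ "targets S \<times> targets S"])
       (auto simp: linking_pairs_def finite_targets[OF assms(1)])
  have prod: "(\<Prod>x\<in>S. r x (f x)) = ?P f * (r u (f u) * r v (f v))" for f
  proof -
    have "S = insert u (insert v (S - {u, v}))" using assms by auto
    hence "(\<Prod>x\<in>S. r x (f x)) = (\<Prod>x\<in>insert u (insert v (S - {u, v})). r x (f x))" by simp
    also have "\<dots> = r u (f u) * (r v (f v) * ?P f)"
      using assms by (subst prod.insert; (subst prod.insert)?) auto
    finally show ?thesis by (simp add: ac_simps)
  qed
  have "(\<Sum>g\<in>?G. ?P g * (\<Sum>(\<alpha>, \<beta>)\<in>linking_pairs S u v g. r u \<alpha> * r v \<beta>)) =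
     (\<Sum>(g, p)\<in>(SIGMA g:?G. linking_pairs S u v g). ?P g * (r u (fst p) * r v (snd p)))"
    using finG finL by (simp add: sum.Sigma sum_distrib_left split_def)
  also have "\<dots> = forest_sum S r"
    unfolding forest_sum_def
  proof (rule sum.reindex_bij_witness[where
        i = "\<lambda>f. (f(u := None, v := None), (f u, f v))" and
        j = "\<lambda>(g, p). g(u := fst p, v := snd p)"], goal_cases)
    case (1 a)
    thus ?case using assms by (auto simp: fun_eq_iff)
  next
    case (2 a)
    then obtain g \<alpha> \<beta> where [simp]: "a = (g, (\<alpha>, \<beta>))"
      and g: "g \<in> forests S" and p: "(\<alpha>, \<beta>) \<in> linking_pairs S u v g" by (cases a) auto
    have "dom (g(u := \<alpha>, v := \<beta>)) \<subseteq> S" using g assms by (auto simp: forests_def)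
    moreover have "ran (g(u := \<alpha>, v := \<beta>)) \<subseteq> S"
      using g p by (auto simp: forests_def ran_def linking_pairs_def targets_def split: if_splits)
    ultimately show ?case using p by (simp add: forests_def linking_pairs_def)
  next
    case (3 f)
    show ?case using assms by (auto simp: fun_eq_iff)
  next
    case (4 f)
    have "Map.graph (f(u := None, v := None)) \<subseteq> Map.graph f"
      by (auto simp: Map.graph_def split: if_splits)
    hence "f(u := None, v := None) \<in> forests S"
      using 4 by (auto simp: forests_def ran_def split: if_splits intro: acyclic_subset)
    moreover have "f(u := None, v := None, u := f u, v := f v) = f"
      by (auto simp: fun_eq_iff)
    ultimately show ?case
      using 4 forest_value[OF 4] assms by (auto simp: linking_pairs_def forests_def)
  next
    case (5 a)
    then obtain g \<alpha> \<beta> where [simp]: "a = (g, (\<alpha>, \<beta>))" by (cases a) auto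
    have "?P (g(u := \<alpha>, v := \<beta>)) = ?P g" by (rule prod.cong) auto
    thus ?case using assms by (simp add: prod)
  qed
  finally show ?thesis by simp
qed

text \<open>Let \<open>A\<close>, \<open>B\<close>, \<open>R\<close> be the targets from which \<open>g\<close> leads to \<open>u\<close>, to \<open>v\<close>, to a root. The pairs
  closing no cycle are \<open>R \<times> R \<union> R \<times> A \<union> B \<times> R\<close>; since both coordinates carry the same weights, this
  weighs as much as \<open>R \<times> (R \<union> A \<union> B)\<close>.\<close>

lemma linking_pairs_sum:
  fixes q :: "'a option \<Rightarrow> 'b::comm_semiring_1"
  assumes "finite S" "u \<in> S" "v \<in> S" "u \<noteq> v" "g \<in> forests S" "g u = None" "g v = None"
  shows "(\<Sum>(\<alpha>, \<beta>)\<in>linking_pairs S u v g. q \<alpha> * q \<beta>) =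
    sum q (targets S) * (\<Sum>(\<alpha>, \<beta>)\<in>linking_pairs S u v g. forced v \<alpha> * q \<beta>)"
proof -
  let ?E = "Map.graph g"
  define A where "A = Some ` {y \<in> S. (y, u) \<in> ?E\<^sup>*}"
  define B where "B = Some ` {y \<in> S. (y, v) \<in> ?E\<^sup>*}"
  define R where "R = targets S - A - B"
  have nodom: "u \<notin> Domain ?E" "v \<notin> Domain ?E" using assms by (auto simp: Map.graph_def)
  \<comment> \<open>Both \<open>u\<close> and \<open>v\<close> are sinks of \<open>g\<close>,
    whereas a target leading to both would make one of them lead to the other.\<close>
  have disj: "A \<inter> B = {}"
  proof -
    have False if "(y, u) \<in> ?E\<^sup>*" "(y, v) \<in> ?E\<^sup>*" for y
    proof -
      have "(u, v) \<in> ?E\<^sup>* \<or> (v, u) \<in> ?E\<^sup>*"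
        using single_valued_confluent[OF single_valued_graph that] .
      thus False using assms(4) nodom by (metis Domain.DomainI converse_rtranclE)
    qed
    thus ?thesis by (auto simp: A_def B_def)
  qed
  have sub: "A \<subseteq> targets S" "B \<subseteq> targets S" by (auto simp: A_def B_def targets_def)
  have fin: "finite A" "finite B" "finite R"
    using finite_targets[OF assms(1)] sub by (auto simp: R_def dest: finite_subset)
  \<comment> \<open>A cycle must use the new arc of \<open>u\<close> alone, that of \<open>v\<close>
    alone, or both; these are the three excluded cases.\<close>
  have "acyclic (Map.graph (g(u := \<alpha>, v := \<beta>))) \<longleftrightarrow> \<alpha> \<notin> A \<and> \<beta> \<notin> B \<and> \<not> (\<beta> \<in> A \<and> \<alpha> \<in> B)"
    if "\<alpha> \<in> targets S" "\<beta> \<in> targets S" for \<alpha> \<beta>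
  proof -
    have ac: "acyclic ?E" using assms by (simp add: forests_def)
    have gv: "(g(u := \<alpha>)) v = None" using assms by simp
    have gr: "Map.graph (g(u := Some a)) = insert (u, a) ?E" for a
      using assms by (simp add: fun_upd_idem)
    show ?thesis
      unfolding acyclic_graph_upd[where g = "g(u := \<alpha>)" and u = v, OF gv]
        acyclic_graph_upd[of g, OF assms(6)]
      using ac that assms
      by (cases \<alpha>; cases \<beta>)
         (auto simp: gr fun_upd_idem rtrancl_insert A_def B_def targets_def image_iff)
  qed
  hence "linking_pairs S u v g =
      {(\<alpha>, \<beta>). \<alpha> \<in> targets S \<and> \<beta> \<in> targets S \<and> \<alpha> \<notin> A \<and> \<beta> \<notin> B \<and> \<not> (\<beta> \<in> A \<and> \<alpha> \<in> B)}"
    unfolding linking_pairs_def by blast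
  also have "\<dots> = R \<times> R \<union> R \<times> A \<union> B \<times> R"
    using disj sub unfolding R_def by blast
  finally have LP: "linking_pairs S u v g = R \<times> R \<union> R \<times> A \<union> B \<times> R" .
  have split: "(\<Sum>p\<in>linking_pairs S u v g. F p) =
     (\<Sum>p\<in>R \<times> R. F p) + (\<Sum>p\<in>R \<times> A. F p) + (\<Sum>p\<in>B \<times> R. F p)" for F :: "_ \<Rightarrow> 'b"
    unfolding LP using fin disj
    by (subst sum.union_disjoint; (subst sum.union_disjoint)?) (auto simp: R_def)
  have rect: "(\<Sum>(\<alpha>, \<beta>)\<in>X \<times> Y. p \<alpha> * q \<beta>) = sum p X * sum q Y" for p and X Y :: "'a option set"
    by (simp add: sum_product sum.cartesian_product)
  \<comment> \<open>Forcing \<open>u\<close> to \<open>v\<close> leaves only the rectangle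
    \<open>B \<times> R\<close>, with weight \<open>sum q R\<close>.\<close>
  have vB: "Some v \<in> B" using assms by (auto simp: B_def)
  have fR: "sum (forced v) R = (0::'b)" using vB by (auto simp: R_def forced_def intro!: sum.neutral)
  have fB: "sum (forced v) B = (1::'b)" using vB fin by (simp add: forced_def)
  have RA: "R \<inter> A = {}" and RAB: "(R \<union> A) \<inter> B = {}" using disj by (auto simp: R_def)
  have "targets S = R \<union> A \<union> B" using sub by (auto simp: R_def)
  hence tot: "sum q (targets S) = sum q R + sum q A + sum q B"
    using fin RA RAB by (simp add: sum.union_disjoint)
  show ?thesis unfolding split rect fR fB tot by (simp add: algebra_simps)
qed

text \<open>The identity of \<open>linking_pairs_sum\<close> applies for each fixed
  \<open>g\<close>, and the row total it yields is the same for all \<open>g\<close>.\<close>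

lemma forest_sum_twins:
  fixes r :: "'a \<Rightarrow> 'a option \<Rightarrow> 'b::comm_semiring_1"
  assumes "finite S" "u \<in> S" "v \<in> S" "u \<noteq> v" "r u = r v"
  shows "forest_sum S r = sum (r v) (targets S) * forest_sum S (r(u := forced v))"
proof -
  let ?r = "r(u := forced v)"
  have "(\<Prod>x\<in>S - {u, v}. r x (g x)) * (\<Sum>(\<alpha>, \<beta>)\<in>linking_pairs S u v g. r u \<alpha> * r v \<beta>) =
      sum (r v) (targets S) * ((\<Prod>x\<in>S - {u, v}. ?r x (g x)) *
        (\<Sum>(\<alpha>, \<beta>)\<in>linking_pairs S u v g. ?r u \<alpha> * ?r v \<beta>))"
    if "g \<in> {g \<in> forests S. g u = None \<and> g v = None}" for g
  proof -
    have "(\<Prod>x\<in>S - {u, v}. ?r x (g x)) = (\<Prod>x\<in>S - {u, v}. r x (g x))"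
      by (rule prod.cong) auto
    thus ?thesis
      using linking_pairs_sum[OF assms(1-4), of g "r v"] that assms(4,5)
      by (simp add: mult.left_commute)
  qed
  thus ?thesis
    unfolding forest_sum_split[OF assms(1-4)] sum_distrib_left by (rule sum.cong[OF refl])
qed

text \<open>The vertices of \<open>K\<close> are forced one at a time. The row of \<open>v\<close>
  never changes, so each remaining vertex is still a twin of \<open>v\<close> and contributes the
  same total.\<close>

lemma forest_sum_twin_class:
  fixes r :: "'a \<Rightarrow> 'a option \<Rightarrow> 'b::comm_semiring_1"
  assumes "finite S" "K \<subseteq> S" "v \<in> S" "v \<notin> K" "\<And>x. x \<in> K \<Longrightarrow> r x = r v"
  shows "forest_sum S r =
    sum (r v) (targets S) ^ card K * forest_sum S (\<lambda>x. if x \<in> K then forced v else r x)"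
proof -
  have "finite K" using assms(1,2) finite_subset by blast
  thus ?thesis using assms(2,4,5)
  proof (induction K)
    case empty
    show ?case by simp
  next
    case (insert k K)
    let ?r = "\<lambda>x. if x \<in> K then forced v else r x"
    have "forest_sum S r = sum (r v) (targets S) ^ card K * forest_sum S ?r"
      using insert by auto
    also have "forest_sum S ?r = sum (r v) (targets S) * forest_sum S (?r(k := forced v))"
      using forest_sum_twins[of S k v ?r] insert assms(1,3) by auto
    also have "?r(k := forced v) = (\<lambda>x. if x \<in> insert k K then forced v else r x)"
      by auto
    finally show ?case using insert by (simp add: ac_simps)
  qed
qed

section \<open>Forests containing prescribed arcs\<close>

lemma forced_arcs_subset_graph:
  assumes "\<And>v. v \<in> D \<Longrightarrow> f v = Some (H v)"
  shows "{(x, H x) |x. x \<in> D}\<^sup>* \<subseteq> (Map.graph f)\<^sup>*"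
  using assms by (intro rtrancl_mono) (auto simp: Map.graph_def)

lemma forest_no_back_arc:
  assumes "f \<in> forests S" "f v = Some z" "(z, v) \<in> (Map.graph f)\<^sup>*"
  shows False
  using assms by (metis (no_types, lifting) acyclic_def forests_def in_graphI mem_Collect_eq
      rtrancl_into_trancl2)

text \<open>A forest that disobeys a forced row has weight zero on both sides. Any other forest
  contains all forced arcs, so an arc from \<open>v\<close> to a vertex leading back to
  \<open>v\<close> would close a cycle; entries at such targets never count.\<close>

lemma forest_sum_cong_back_arcs:
  fixes r r' :: "'a \<Rightarrow> 'a option \<Rightarrow> 'b::comm_semiring_1"
  assumes "finite S" "D \<subseteq> S"
    and D: "\<And>v. v \<in> D \<Longrightarrow> r v = forced (H v)" "\<And>v. v \<in> D \<Longrightarrow> r' v = forced (H v)"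
    and eq: "\<And>v y. v \<in> S \<Longrightarrow> v \<notin> D \<Longrightarrow> y \<in> targets S \<Longrightarrow>
      r v y = r' v y \<or> (\<exists>z. y = Some z \<and> (z, v) \<in> {(x, H x) |x. x \<in> D}\<^sup>*)"
  shows "forest_sum S r = forest_sum S r'"
  unfolding forest_sum_def
proof (rule sum.cong[OF refl])
  fix f assume f: "f \<in> forests S"
  show "(\<Prod>v\<in>S. r v (f v)) = (\<Prod>v\<in>S. r' v (f v))"
  proof (cases "\<exists>v\<in>D. f v \<noteq> Some (H v)")
    case True
    then obtain v where "v \<in> S" "r v (f v) = 0" "r' v (f v) = 0"
      using D assms(2) by (auto simp: forced_def)
    thus ?thesis using assms(1) by (metis prod_zero)
  next
    case False
    hence follow: "{(x, H x) |x. x \<in> D}\<^sup>* \<subseteq> (Map.graph f)\<^sup>*"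
      by (intro forced_arcs_subset_graph) auto
    show ?thesis
    proof (rule prod.cong[OF refl])
      fix v assume v: "v \<in> S"
      show "r v (f v) = r' v (f v)"
      proof (cases "v \<in> D")
        case False
        show ?thesis
          using eq[OF v False forest_value[OF f]]
        proof
          assume "\<exists>z. f v = Some z \<and> (z, v) \<in> {(x, H x) |x. x \<in> D}\<^sup>*"
          then obtain z where "f v = Some z" "(z, v) \<in> (Map.graph f)\<^sup>*"
            using subsetD[OF follow] by auto
          hence False by (rule forest_no_back_arc[OF f])
          thus ?thesis ..
        qed
      qed (simp add: D)
    qed
  qed
qed

text \<open>Only the forest \<open>h\<close> of the forced arcs survives: any other forest violates
  a forced row or gives \<open>\<rho>\<close> a parent, and then the forced path from that parent to
  \<open>\<rho>\<close> closes a cycle.\<close>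

lemma forest_sum_all_forced:
  fixes r :: "'a \<Rightarrow> 'a option \<Rightarrow> 'b::comm_semiring_1"
  assumes "finite S" "\<rho> \<in> S"
    and D: "\<And>v. v \<in> S - {\<rho>} \<Longrightarrow> r v = forced (H v)"
    and reach: "\<And>v. v \<in> S \<Longrightarrow> (v, \<rho>) \<in> {(x, H x) |x. x \<in> S - {\<rho>}}\<^sup>*"
  shows "forest_sum S r = r \<rho> None"
proof -
  define h where "h v = (if v \<in> S - {\<rho>} then Some (H v) else None)" for v
  have gr: "Map.graph h = {(x, H x) |x. x \<in> S - {\<rho>}}"
    by (auto simp: Map.graph_def h_def split: if_splits)
  have "acyclic (Map.graph h)"
    by (rule acyclic_if_reaches_sink[where z = \<rho>])
       (use reach single_valued_graph[of h] in \<open>auto simp: gr\<close>)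
  \<comment> \<open>The forced path from \<open>v\<close> to \<open>\<rho>\<close> continues from
    \<open>H v\<close>, which is therefore \<open>\<rho>\<close> or the source of a forced
    arc.\<close>
  moreover have "H v \<in> S" if "v \<in> S - {\<rho>}" for v
  proof -
    have "(v, \<rho>) \<in> {(x, H x) |x. x \<in> S - {\<rho>}}\<^sup>*" using reach that by simp
    hence "(H v, \<rho>) \<in> {(x, H x) |x. x \<in> S - {\<rho>}}\<^sup>*"
      using that by (auto elim: converse_rtranclE)
    thus ?thesis using assms(2) by (auto elim: converse_rtranclE)
  qed
  ultimately have hF: "h \<in> forests S"
    by (auto simp: forests_def h_def dom_def ran_def)
  have split: "(\<Prod>v\<in>S. r v (f v)) = r \<rho> (f \<rho>) * (\<Prod>v\<in>S - {\<rho>}. r v (f v))" for f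
    using assms by (simp add: prod.remove)
  have zero: "(\<Prod>v\<in>S. r v (f v)) = 0" if f: "f \<in> forests S" "f \<noteq> h" for f
  proof -
    have "\<exists>v\<in>S - {\<rho>}. f v \<noteq> Some (H v)"
    proof (rule ccontr)
      assume "\<not> ?thesis"
      hence eq: "\<And>v. v \<in> S - {\<rho>} \<Longrightarrow> f v = Some (H v)" by blast
      have "f \<rho> = None"
      proof (rule ccontr)
        assume "f \<rho> \<noteq> None"
        then obtain z where z: "f \<rho> = Some z" by auto
        hence "z \<in> S" using f by (auto simp: forests_def ran_def)
        hence "(z, \<rho>) \<in> (Map.graph f)\<^sup>*"
          using subsetD[OF forced_arcs_subset_graph[OF eq] reach] by simp
        thus False using forest_no_back_arc f z by metis
      qed
      moreover have "f v = None" if "v \<notin> S" for v using that f by (auto simp: forests_def)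
      ultimately have "f = h" using eq by (auto simp: h_def fun_eq_iff)
      thus False using f by simp
    qed
    then obtain v where v: "v \<in> S - {\<rho>}" "f v \<noteq> Some (H v)" by blast
    hence "r v (f v) = 0" using D[OF v(1)] by (simp add: forced_def)
    thus ?thesis using assms(1) v(1) by (metis DiffD1 prod_zero)
  qed
  have "forest_sum S r = (\<Sum>f\<in>{h}. \<Prod>v\<in>S. r v (f v))"
    unfolding forest_sum_def
    by (rule sum.mono_neutral_right) (use hF zero finite_forests assms(1) in auto)
  also have "\<dots> = r \<rho> (h \<rho>) * (\<Prod>v\<in>S - {\<rho>}. r v (h v))"
    by (simp add: split)
  also have "(\<Prod>v\<in>S - {\<rho>}. r v (h v)) = 1"
    by (rule prod.neutral) (simp add: h_def D forced_def)
  finally show ?thesis by (simp add: h_def)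
qed

section \<open>Spanning trees as one-rooted forests\<close>

definition rooted_spanning_trees :: "'a set \<Rightarrow> 'a set set \<Rightarrow> 'a \<Rightarrow> ('a \<rightharpoonup> 'a) set" where
  "rooted_spanning_trees V E \<rho> =
     {f \<in> forests V. {v \<in> V. f v = None} = {\<rho>} \<and> (\<forall>x y. f x = Some y \<longrightarrow> {x, y} \<in> E)}"

definition arc_edges :: "('a \<rightharpoonup> 'a) \<Rightarrow> 'a set set" where
  "arc_edges f = {{x, y} |x y. f x = Some y}"

lemma forest_no_2cycle:
  assumes "f \<in> forests S" "f x = Some y" "f y = Some x"
  shows False
  using forest_no_back_arc[OF assms(1,2)] assms(3) by (meson in_graphI r_into_rtrancl)

text \<open>Two vertices giving the same edge would point to each other.\<close>

lemma card_arc_edges: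
  assumes "f \<in> forests S"
  shows "card (arc_edges f) = card (dom f)"
proof -
  have "arc_edges f = (\<lambda>x. {x, the (f x)}) ` dom f"
    by (auto simp: arc_edges_def image_iff) (metis domI option.sel)
  moreover have "inj_on (\<lambda>x. {x, the (f x)}) (dom f)"
    using forest_no_2cycle[OF assms] by (fastforce simp: inj_on_def doubleton_eq_iff)
  ultimately show ?thesis by (simp add: card_image)
qed

lemma rooted_spanning_tree_dom:
  assumes "f \<in> rooted_spanning_trees V E \<rho>"
  shows "dom f = V - {\<rho>}"
proof -
  have "dom f \<subseteq> V" "{v \<in> V. f v = None} = {\<rho>}"
    using assms by (simp_all add: rooted_spanning_trees_def forests_def)
  moreover from this have "f \<rho> = None" by blast
  ultimately show ?thesis by auto
qed

lemma rooted_spanning_tree_reaches: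
  assumes "finite V" "f \<in> rooted_spanning_trees V E \<rho>" "x \<in> V"
  shows "(x, \<rho>) \<in> (Map.graph f)\<^sup>*"
  using forest_reaches_root[of V f x] assms by (auto simp: rooted_spanning_trees_def)

lemma arc_edges_spanning_tree:
  assumes "finite V" "\<rho> \<in> V" "f \<in> rooted_spanning_trees V E \<rho>"
  shows "arc_edges f \<in> spanning_trees V E"
proof -
  have f: "f \<in> forests V" using assms by (simp add: rooted_spanning_trees_def)
  let ?R = "{(x, y). {x, y} \<in> arc_edges f}"
  have "Map.graph f \<subseteq> ?R" by (auto simp: Map.graph_def arc_edges_def)
  hence "(Map.graph f)\<^sup>* \<subseteq> ?R\<^sup>*" by (rule rtrancl_mono)
  hence to: "(x, \<rho>) \<in> ?R\<^sup>*" if "x \<in> V" for x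
    using rooted_spanning_tree_reaches[OF assms(1,3) that] by blast
  have "sym ?R" by (auto simp: sym_def insert_commute)
  hence "sym (?R\<^sup>*)" by (rule sym_rtrancl)
  hence "(u, v) \<in> ?R\<^sup>*" if "u \<in> V" "v \<in> V" for u v
    using to[OF that(1)] symD[OF _ to[OF that(2)]] rtrancl_trans by fast
  hence "connected_graph V (arc_edges f)"
    using assms(2) by (auto simp: connected_graph_def)
  moreover have "arc_edges f \<subseteq> E"
    using assms(3) by (auto simp: rooted_spanning_trees_def arc_edges_def)
  moreover have "card (arc_edges f) = card V - 1"
    using card_arc_edges[OF f] rooted_spanning_tree_dom[OF assms(3)] assms(1,2) by simp
  ultimately show ?thesis by (simp add: spanning_trees_def)
qed

text \<open>If \<open>f v \<noteq> g v\<close>, then the edge of \<open>g\<close> at \<open>v\<close> must be traversed by \<open>f\<close> in the opposite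
  direction, so \<open>f\<close> and \<open>g\<close> also differ at \<open>g v\<close>; hence they differ all the way up to the root.\<close>

lemma arc_edges_inj:
  assumes "finite V"
  shows "inj_on arc_edges (rooted_spanning_trees V E \<rho>)"
proof (rule inj_onI)
  fix f g assume f: "f \<in> rooted_spanning_trees V E \<rho>" and g: "g \<in> rooted_spanning_trees V E \<rho>"
    and eq: "arc_edges f = arc_edges g"
  have gF: "g \<in> forests V" using g by (simp add: rooted_spanning_trees_def)
  have dom: "dom f = V - {\<rho>}" "dom g = V - {\<rho>}"
    using rooted_spanning_tree_dom[OF f] rooted_spanning_tree_dom[OF g] by simp_all
  have "f v = g v" if "(v, \<rho>) \<in> (Map.graph g)\<^sup>*" for v
    using that
  proof (induction rule: converse_rtrancl_induct)
    case base
    show ?case using dom by (metis Diff_iff domIff singletonI)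
  next
    case (step v u)
    hence gv: "g v = Some u" by (simp add: in_graphD)
    hence "{v, u} \<in> arc_edges f" unfolding eq by (auto simp: arc_edges_def)
    then obtain a b where ab: "f a = Some b" "{v, u} = {a, b}" by (auto simp: arc_edges_def)
    have False if "f u = Some v"
      using that step.IH gv forest_no_2cycle[OF gF gv] by simp
    thus ?case using ab gv by (auto simp: doubleton_eq_iff)
  qed
  hence "f v = g v" if "v \<in> V" for v
    using rooted_spanning_tree_reaches[OF assms g that] by blast
  moreover have "f v = g v" if "v \<notin> V" for v
    using that dom by (metis Diff_iff domIff)
  ultimately show "f = g" by blast
qed

text \<open>Every vertex other than \<open>\<rho>\<close> picks a neighbour strictly closer to
  \<open>\<rho>\<close>, as in breadth-first search; acyclicity follows because the distance drops
  along each arc.\<close>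

lemma connected_imp_rooted_tree:
  assumes V: "finite V" "\<rho> \<in> V" and F: "connected_graph V F" "\<And>e. e \<in> F \<Longrightarrow> e \<subseteq> V"
  obtains f where "f \<in> rooted_spanning_trees V F \<rho>"
proof -
  let ?R = "{(x, y). {x, y} \<in> F}"
  define d where "d v = (LEAST k. (v, \<rho>) \<in> ?R ^^ k)" for v
  have path: "(v, \<rho>) \<in> ?R ^^ d v" if "v \<in> V" for v
  proof -
    have "(v, \<rho>) \<in> ?R\<^sup>*" using F(1) V(2) that by (simp add: connected_graph_def)
    then obtain k where "(v, \<rho>) \<in> ?R ^^ k" using rtrancl_imp_relpow by blast
    thus ?thesis unfolding d_def by (rule LeastI)
  qed
  have ex: "\<exists>y. {v, y} \<in> F \<and> d y < d v" if "v \<in> V - {\<rho>}" for v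
  proof -
    have p: "(v, \<rho>) \<in> ?R ^^ d v" using path that by simp
    have "d v \<noteq> 0"
    proof
      assume "d v = 0"
      thus False using p that by simp
    qed
    then obtain k where k: "d v = Suc k" by (cases "d v") auto
    with p have "(v, \<rho>) \<in> ?R ^^ Suc k" by simp
    then obtain y where "(v, y) \<in> ?R" "(y, \<rho>) \<in> ?R ^^ k" by (meson relpow_Suc_D2)
    moreover have "d y \<le> k" unfolding d_def by (rule Least_le) fact
    ultimately show ?thesis using k by auto
  qed
  define f where "f v = (if v \<in> V - {\<rho>} then Some (SOME y. {v, y} \<in> F \<and> d y < d v) else None)" for v
  have f: "{x, y} \<in> F \<and> d y < d x \<and> x \<in> V - {\<rho>}" if "f x = Some y" for x y
  proof -
    have x: "x \<in> V - {\<rho>}" and y: "y = (SOME y. {x, y} \<in> F \<and> d y < d x)"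
      using that by (auto simp: f_def split: if_splits)
    show ?thesis using someI_ex[OF ex[OF x]] x unfolding y by blast
  qed
  have "Map.graph f \<subseteq> (inv_image less_than d)\<inverse>" using f by (auto simp: Map.graph_def)
  moreover have "acyclic ((inv_image less_than d)\<inverse>)"
    unfolding acyclic_converse by (rule wf_acyclic) simp
  ultimately have "acyclic (Map.graph f)" by (meson acyclic_subset)
  moreover have "dom f \<subseteq> V" "ran f \<subseteq> V" using f F(2) by (auto simp: dom_def ran_def)
  ultimately have "f \<in> forests V" by (simp add: forests_def)
  moreover have "{v \<in> V. f v = None} = {\<rho>}" using V(2) by (auto simp: f_def)
  ultimately have "f \<in> rooted_spanning_trees V F \<rho>"
    using f by (simp add: rooted_spanning_trees_def)
  thus thesis by (rule that)
qed

text \<open>For surjectivity of \<open>arc_edges\<close>, a breadth-first tree inside a spanning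
  tree \<open>F\<close> has as many edges as \<open>F\<close>, so it exhausts
  \<open>F\<close>.\<close>

lemma card_rooted_spanning_trees:
  assumes "simple_graph V E" "\<rho> \<in> V"
  shows "card (rooted_spanning_trees V E \<rho>) = card (spanning_trees V E)"
proof -
  have fin: "finite V" and E: "\<And>e. e \<in> E \<Longrightarrow> e \<subseteq> V"
    using assms(1) by (auto simp: simple_graph_def)
  have "F \<in> arc_edges ` rooted_spanning_trees V E \<rho>" if "F \<in> spanning_trees V E" for F
  proof -
    have F: "F \<subseteq> E" "connected_graph V F" "card F = card V - 1"
      using that by (auto simp: spanning_trees_def)
    have "finite F" using F(1) E fin by (meson finite_Pow_iff finite_subset Pow_iff subsetI)
    obtain f where f: "f \<in> rooted_spanning_trees V F \<rho>"
      using connected_imp_rooted_tree[OF fin assms(2) F(2)] E F(1) by blast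
    have "arc_edges f \<in> spanning_trees V F"
      using arc_edges_spanning_tree[OF fin assms(2) f] .
    hence "arc_edges f = F"
      using F(3) \<open>finite F\<close> by (intro card_subset_eq) (auto simp: spanning_trees_def)
    moreover have "f \<in> rooted_spanning_trees V E \<rho>"
      using f F(1) by (auto simp: rooted_spanning_trees_def)
    ultimately show ?thesis by blast
  qed
  hence "arc_edges ` rooted_spanning_trees V E \<rho> = spanning_trees V E"
    using arc_edges_spanning_tree[OF fin assms(2)] by blast
  thus ?thesis using card_image[OF arc_edges_inj[OF fin]] by metis
qed

section \<open>Spanning trees as a coefficient\<close>

definition adjacency_row :: "'a set set \<Rightarrow> 'b::comm_semiring_1 \<Rightarrow> 'a \<Rightarrow> 'a option \<Rightarrow> 'b" where
  "adjacency_row E X u y = (case y of None \<Rightarrow> X | Some x \<Rightarrow> of_bool ({u, x} \<in> E))"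

text \<open>A forest weighs \<open>X\<close> to the number of its roots if all its arcs are edges,
  and zero otherwise; so the coefficient of \<open>X\<close> counts one-rooted forests, here grouped
  by root. The full sum is classically det(X I + L), with L the Laplacian of the graph.\<close>

lemma coeff_forest_sum:
  assumes "simple_graph V E"
  shows "coeff (forest_sum V (adjacency_row E [:0, 1::nat:])) 1 = card V * card (spanning_trees V E)"
proof -
  have fin: "finite V" using assms by (simp add: simple_graph_def)
  have finF: "finite (forests V)" using finite_forests[OF fin] .
  have pow: "[:0, 1::nat:] ^ m = monom 1 m" for m
    by (simp only: monom_altdef smult_1_left)
  have coeff: "coeff (\<Prod>v\<in>V. adjacency_row E [:0, 1::nat:] v (f v)) 1 =
      of_bool (\<exists>\<rho>\<in>V. f \<in> rooted_spanning_trees V E \<rho>)" if f: "f \<in> forests V" for f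
  proof (cases "\<forall>x y. f x = Some y \<longrightarrow> {x, y} \<in> E")
    case True
    have "(\<Prod>v\<in>V. adjacency_row E [:0, 1::nat:] v (f v)) =
        (\<Prod>v\<in>V. if f v = None then [:0, 1:] else 1)"
      using True by (intro prod.cong) (auto simp: adjacency_row_def split: option.splits)
    also have "\<dots> = [:0, 1:] ^ card {v \<in> V. f v = None}"
      using fin by (simp add: prod.If_cases Int_def)
    also have "coeff \<dots> 1 = of_bool (card {v \<in> V. f v = None} = 1)"
      unfolding pow coeff_monom by simp
    finally show ?thesis using f True
      by (auto simp: rooted_spanning_trees_def card_1_singleton_iff of_bool_def)
  next
    case False
    then obtain x y where "f x = Some y" "{x, y} \<notin> E" by auto
    moreover from this have "x \<in> V" using f by (auto simp: forests_def)
    ultimately have "(\<Prod>v\<in>V. adjacency_row E [:0, 1::nat:] v (f v)) = 0"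
      using fin by (intro prod_zero) (auto simp: adjacency_row_def intro!: bexI[of _ x])
    thus ?thesis using False by (auto simp: rooted_spanning_trees_def)
  qed
  have "coeff (forest_sum V (adjacency_row E [:0, 1::nat:])) 1 =
      (\<Sum>f\<in>forests V. of_bool (\<exists>\<rho>\<in>V. f \<in> rooted_spanning_trees V E \<rho>))"
    unfolding forest_sum_def coeff_sum by (rule sum.cong[OF refl]) (rule coeff)
  also have "\<dots> = card (\<Union>\<rho>\<in>V. rooted_spanning_trees V E \<rho>)"
    using finF by (auto simp: sum_of_bool_eq rooted_spanning_trees_def intro!: arg_cong[of _ _ card])
  also have "\<dots> = (\<Sum>\<rho>\<in>V. card (rooted_spanning_trees V E \<rho>))"
    using finF fin by (intro card_UN_disjoint) (auto simp: rooted_spanning_trees_def)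
  also have "\<dots> = card V * card (spanning_trees V E)"
    using card_rooted_spanning_trees[OF assms] by simp
  finally show ?thesis .
qed

section \<open>Collapsing the cotree\<close>

text \<open>The entries other than the root weight mark the leaves counted by the degree of
  \<open>w\<close>. The row depends on \<open>w\<close> and not on a child of \<open>w\<close>,
  which will make the representatives of all children twins.\<close>

definition link_row :: "'a cotree \<Rightarrow> 'b::comm_semiring_1 \<Rightarrow> 'a \<Rightarrow> 'a option \<Rightarrow> 'b" where
  "link_row T X w y = (case y of None \<Rightarrow> X
     | Some x \<Rightarrow> of_bool (tlabel T (lca T (tparent T x) w) = JoinNode))"

locale labelled_cotree =
  fixes T :: "'a cotree" and V :: "'a set" and E :: "'a set set"
  assumes rooted: "rooted_tree T" and leaves: "tree_leaves T = V"
    and adjacent: "\<lbrakk>u \<in> V; v \<in> V; u \<noteq> v\<rbrakk> \<Longrightarrow> {u, v} \<in> E \<longleftrightarrow> tlabel T (lca T u v) = JoinNode"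
begin

abbreviation below :: "('a \<times> 'a) set" where
  "below \<equiv> (parent_rel T)\<^sup>*"

definition leaves_below :: "'a \<Rightarrow> 'a set" where
  "leaves_below w = {v \<in> V. (v, w) \<in> below}"

definition interior_below :: "'a \<Rightarrow> 'a set" where
  "interior_below w = {z \<in> interior_nodes T. (z, w) \<in> below}"

section \<open>The ancestor order of the cotree\<close>

lemma finite_nodes: "finite (tnodes T)"
  using rooted by (simp add: rooted_tree_def)

lemma parent_rel_nodes: "parent_rel T \<subseteq> tnodes T \<times> tnodes T"
  using rooted by (simp add: rooted_tree_def)

lemma below_root: "x \<in> tnodes T \<Longrightarrow> (x, troot T) \<in> below"
  using rooted by (simp add: rooted_tree_def)

lemma V_subset_nodes: "V \<subseteq> tnodes T"
  using leaves by (auto simp: tree_leaves_def)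

lemma finite_V: "finite V"
  using V_subset_nodes finite_nodes by (rule finite_subset)

lemma single_valued_parent: "single_valued (parent_rel T)"
  by (auto simp: single_valued_def parent_rel_def)

lemma tparent_eq: "(x, y) \<in> parent_rel T \<Longrightarrow> tparent T x = y"
  by (auto simp: parent_rel_def)

lemma acyclic_parent: "acyclic (parent_rel T)"
  by (rule acyclic_if_reaches_sink[where z = "troot T", OF single_valued_parent])
     (auto intro!: below_root dest: subsetD[OF parent_rel_nodes], simp add: parent_rel_def)

lemma wf_parent: "wf (parent_rel T)"
  using acyclic_parent parent_rel_nodes finite_nodes
  by (meson finite_SigmaI finite_acyclic_wf finite_subset)

lemma below_antisym: "(x, y) \<in> below \<Longrightarrow> (y, x) \<in> below \<Longrightarrow> x = y"
  using acyclic_parent by (metis acyclic_def rtranclD rtrancl_trancl_trancl)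

lemma below_linear: "(x, y) \<in> below \<Longrightarrow> (x, z) \<in> below \<Longrightarrow> (y, z) \<in> below \<or> (z, y) \<in> below"
  by (rule single_valued_confluent[OF single_valued_parent])

lemma parent_below:
  assumes "(x, y) \<in> below" "x \<noteq> y"
  shows "(x, tparent T x) \<in> parent_rel T" "(tparent T x, y) \<in> below"
  using assms tparent_eq by (metis converse_rtranclE)+

lemma below_leaf: "x \<in> V \<Longrightarrow> (y, x) \<in> below \<Longrightarrow> y = x"
  using leaves by (auto simp: tree_leaves_def tree_children_def elim: rtranclE)

lemma below_iff_child:
  "(x, w) \<in> below \<longleftrightarrow> x = w \<or> (\<exists>c\<in>tree_children T w. (x, c) \<in> below)"
  by (auto simp: tree_children_def elim: rtranclE)

text \<open>The ancestors of \<open>x\<close> form a chain, so \<open>c\<close> and \<open>d\<close>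
  are comparable. If they differed, the parent \<open>w\<close> of the lower one would lie at or
  below the other, itself a child of \<open>w\<close>.\<close>

lemma children_below_disjoint:
  assumes "c \<in> tree_children T w" "d \<in> tree_children T w" "(x, c) \<in> below" "(x, d) \<in> below"
  shows "c = d"
proof -
  have *: "c = d" if "(c, d) \<in> below" "(c, w) \<in> parent_rel T" "(d, w) \<in> parent_rel T" for c d
  proof (rule ccontr)
    assume "c \<noteq> d"
    hence "(w, d) \<in> below" using that parent_below tparent_eq by metis
    hence "w = d" using that(3) below_antisym by blast
    thus False using that(3) acyclic_parent by (auto simp: acyclic_def)
  qed
  show ?thesis
    using below_linear[OF assms(3,4)] assms(1,2) * by (auto simp: tree_children_def)
qed

section \<open>Least common ancestors and adjacency\<close>

lemma lca_eqI:
  assumes "(x, z) \<in> below" "(y, z) \<in> below"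
    "\<And>a. (x, a) \<in> below \<Longrightarrow> (y, a) \<in> below \<Longrightarrow> (z, a) \<in> below"
  shows "lca T x y = z"
  unfolding lca_def is_ancestor_def
  by (rule the_equality) (use assms below_antisym in blast)+

lemma lca_ancestor: "(x, z) \<in> below \<Longrightarrow> lca T x z = z"
  by (rule lca_eqI) auto

text \<open>A common ancestor is comparable with \<open>c\<close> but not below it, since
  \<open>x\<close> is not; hence it lies strictly above \<open>c\<close>, that is, at or above
  \<open>w\<close>.\<close>

lemma lca_different_children:
  assumes "c \<in> tree_children T w" "(u, c) \<in> below" "(x, w) \<in> below" "(x, c) \<notin> below"
  shows "lca T u x = w"
proof (rule lca_eqI)
  have cw: "(c, w) \<in> parent_rel T" using assms by (simp add: tree_children_def)
  thus "(u, w) \<in> below" using assms(2) by simp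
  show "(x, w) \<in> below" by fact
  fix a assume a: "(u, a) \<in> below" "(x, a) \<in> below"
  have "(a, c) \<notin> below" using a assms by (meson rtrancl_trans)
  hence "(c, a) \<in> below" "c \<noteq> a" using below_linear[OF a(1) assms(2)] by auto
  thus "(w, a) \<in> below" using parent_below(2) tparent_eq[OF cw] by metis
qed

text \<open>Both sides describe the same set of common ancestors: one of \<open>u\<close> and
  \<open>x\<close> lies above \<open>w\<close>, because \<open>x\<close> is not below
  \<open>w\<close>, and properly above \<open>x\<close>, because \<open>x\<close> is a leaf other
  than \<open>u\<close>.\<close>

lemma lca_outside:
  assumes "u \<in> V" "(u, w) \<in> below" "x \<in> V" "(x, w) \<notin> below" "w \<in> tnodes T"
  shows "lca T u x = lca T (tparent T x) w"
proof -
  \<comment> \<open>The value of \<open>tparent\<close> is meaningless at the root. If the leaf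
    \<open>x\<close> were the root, \<open>w\<close> would have to be \<open>x\<close>.\<close>
  have "x \<noteq> troot T"
  proof
    assume "x = troot T"
    hence "(w, x) \<in> below" using below_root assms by simp
    thus False using below_leaf[OF assms(3)] assms(4) by auto
  qed
  hence px: "(x, tparent T x) \<in> parent_rel T"
    using assms V_subset_nodes by (auto simp: parent_rel_def)
  have "(u, a) \<in> below \<and> (x, a) \<in> below \<longleftrightarrow> (tparent T x, a) \<in> below \<and> (w, a) \<in> below" for a
  proof
    assume a: "(u, a) \<in> below \<and> (x, a) \<in> below"
    have "(a, w) \<notin> below" using a assms(4) by (meson rtrancl_trans)
    hence "(w, a) \<in> below" using below_linear a assms(2) by blast
    moreover have "x \<noteq> a" using a below_leaf[OF assms(3)] assms(2,4) by blast
    ultimately show "(tparent T x, a) \<in> below \<and> (w, a) \<in> below"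
      using a parent_below(2) by blast
  next
    assume "(tparent T x, a) \<in> below \<and> (w, a) \<in> below"
    thus "(u, a) \<in> below \<and> (x, a) \<in> below"
      using px assms(2) by (meson converse_rtrancl_into_rtrancl rtrancl_trans)
  qed
  thus ?thesis by (simp add: lca_def is_ancestor_def flip: conj_assoc)
qed

text \<open>A leaf \<open>x\<close> not below \<open>c\<close> sees all leaves below
  \<open>c\<close> alike: if \<open>x\<close> is below \<open>w\<close>, the least common ancestor
  is \<open>w\<close>, otherwise it is that of \<open>w\<close> and the parent of
  \<open>x\<close>.\<close>

lemma adjacency_row_eq_link_row:
  assumes "c \<in> tree_children T w" "u \<in> leaves_below c" "y \<in> targets V" "y \<notin> Some ` leaves_below c"
  shows "adjacency_row E X u y = link_row T X w y"
proof (cases y)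
  case None
  thus ?thesis by (simp add: adjacency_row_def link_row_def)
next
  case (Some x)
  have x: "x \<in> V" "(x, c) \<notin> below" using assms Some by (auto simp: targets_def leaves_below_def)
  have u: "u \<in> V" "(u, c) \<in> below" using assms by (auto simp: leaves_below_def)
  have cw: "(c, w) \<in> parent_rel T" using assms by (simp add: tree_children_def)
  have w: "w \<in> tnodes T" using cw parent_rel_nodes by auto
  have "lca T u x = lca T (tparent T x) w"
  proof (cases "(x, w) \<in> below")
    case True
    have "x \<noteq> w" using cw x(1) leaves by (auto simp: tree_leaves_def tree_children_def)
    thus ?thesis
      using lca_different_children[OF assms(1) u(2) True x(2)] lca_ancestor parent_below(2) True
      by metis
  next
    case False
    thus ?thesis using lca_outside[OF u(1) _ x(1) False w] rtrancl_into_rtrancl[OF u(2) cw] by simp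
  qed
  moreover have "u \<noteq> x" using u x by auto
  ultimately show ?thesis
    using Some adjacent[OF u(1) x(1)] by (simp add: adjacency_row_def link_row_def)
qed

lemma sum_link_row:
  "sum (link_row T X w) (targets V) = X + of_nat (interior_degree T w)"
proof -
  have "sum (link_row T X w) (targets V) =
      X + (\<Sum>x\<in>V. of_bool (tlabel T (lca T (tparent T x) w) = JoinNode))"
    using finite_V by (simp add: targets_def sum.reindex link_row_def)
  thus ?thesis using finite_V by (simp add: interior_degree_def leaves sum_of_bool_eq Int_def)
qed

section \<open>Induction over the subtrees\<close>

lemma leaf_or_interior: "w \<in> tnodes T \<Longrightarrow> w \<in> V \<or> w \<in> interior_nodes T"
  using leaves by (auto simp: interior_nodes_def)

lemma leaves_below_leaf: "w \<in> V \<Longrightarrow> leaves_below w = {w}"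
  by (auto simp: leaves_below_def dest: below_leaf)

lemma interior_below_leaf: "w \<in> V \<Longrightarrow> interior_below w = {}"
  using leaves by (auto simp: interior_below_def interior_nodes_def dest: below_leaf)

lemma leaves_below_interior:
  "w \<in> interior_nodes T \<Longrightarrow> leaves_below w = (\<Union>c\<in>tree_children T w. leaves_below c)"
  using leaves by (auto simp: leaves_below_def interior_nodes_def below_iff_child[of _ w])

lemma interior_below_interior:
  "w \<in> interior_nodes T \<Longrightarrow>
    interior_below w = insert w (\<Union>c\<in>tree_children T w. interior_below c)"
  by (auto simp: interior_below_def below_iff_child[of _ w])

lemma children_nodes: "tree_children T w \<subseteq> tnodes T"
  using parent_rel_nodes by (auto simp: tree_children_def)

lemma finite_children: "finite (tree_children T w)"
  using children_nodes finite_nodes by (rule finite_subset)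

definition subtree_factor :: "'b::comm_semiring_1 \<Rightarrow> 'a \<Rightarrow> 'b" where
  "subtree_factor X w =
     (\<Prod>z\<in>interior_below w. (X + of_nat (interior_degree T z)) ^ (card (tree_children T z) - 1))"

lemma subtree_factor_interior:
  assumes "w \<in> interior_nodes T"
  shows "subtree_factor X w =
    (X + of_nat (interior_degree T w)) ^ (card (tree_children T w) - 1) *
    (\<Prod>c\<in>tree_children T w. subtree_factor X c)"
proof -
  have fin: "finite (interior_below z)" for z
    using finite_nodes by (auto simp: interior_below_def interior_nodes_def)
  have "w \<notin> interior_below c" if "c \<in> tree_children T w" for c
    using that acyclic_parent
    by (auto simp: interior_below_def tree_children_def acyclic_def dest: rtrancl_into_trancl1)
  moreover have "interior_below c \<inter> interior_below d = {}"
    if "c \<in> tree_children T w" "d \<in> tree_children T w" "c \<noteq> d" for c d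
    using children_below_disjoint that by (fastforce simp: interior_below_def)
  ultimately show ?thesis
    using fin finite_children
    by (simp add: subtree_factor_def interior_below_interior[OF assms] prod.UNION_disjoint)
qed

text \<open>The children are collapsed one at a time. Sibling leaf sets are disjoint, so earlier
  collapses leave the rows below the next child intact, and \<open>collapse\<close> constrains
  \<open>r\<close> only there.\<close>

lemma forest_sum_collapse_children:
  fixes X :: "'b::comm_semiring_1"
  assumes "C \<subseteq> tree_children T w"
    and collapse: "\<And>c r. c \<in> C \<Longrightarrow> (\<forall>v\<in>leaves_below c. r v = adjacency_row E X v) \<Longrightarrow>
      forest_sum V r = subtree_factor X c *
        forest_sum V (\<lambda>v. if v \<in> leaves_below c - {\<rho> c} then forced (H v) else r v)"
    and "\<And>v. v \<in> (\<Union>c\<in>C. leaves_below c) \<Longrightarrow> r v = adjacency_row E X v"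
  shows "forest_sum V r = (\<Prod>c\<in>C. subtree_factor X c) *
    forest_sum V (\<lambda>v. if v \<in> (\<Union>c\<in>C. leaves_below c - {\<rho> c}) then forced (H v) else r v)"
proof -
  have "finite C" using assms(1) finite_children by (rule finite_subset)
  thus ?thesis using assms
  proof (induction C)
    case empty
    show ?case by simp
  next
    case (insert c C)
    let ?r = "\<lambda>v. if v \<in> (\<Union>c\<in>C. leaves_below c - {\<rho> c}) then forced (H v) else r v"
    have disj: "v \<notin> leaves_below d" if "v \<in> leaves_below c" "d \<in> C" for v d
      using that insert.hyps(2) insert.prems(1) children_below_disjoint[of c w d v]
      by (auto simp: leaves_below_def)
    have "forest_sum V r = (\<Prod>c\<in>C. subtree_factor X c) * forest_sum V ?r"
      using insert.prems by (intro insert.IH) auto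
    also have "forest_sum V ?r = subtree_factor X c *
        forest_sum V (\<lambda>v. if v \<in> leaves_below c - {\<rho> c} then forced (H v) else ?r v)"
      using disj insert.prems(3) by (intro insert.prems(2)) auto
    also have "(\<lambda>v. if v \<in> leaves_below c - {\<rho> c} then forced (H v) else ?r v) =
        (\<lambda>v. if v \<in> (\<Union>c\<in>insert c C. leaves_below c - {\<rho> c}) then forced (H v) else r v)"
      by (auto simp: fun_eq_iff)
    finally show ?case using insert.hyps by (simp add: ac_simps)
  qed
qed

text \<open>Here \<open>\<rho>\<close> is the representative of \<open>w\<close>, the only leaf
  below \<open>w\<close> that keeps its row. The rows of the other leaves of the cotree are
  arbitrary, and \<open>\<rho>\<close> and \<open>H\<close> do not depend on them, so that siblings
  can be treated in succession.\<close>

lemma forest_sum_collapse: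
  fixes X :: "'b::comm_semiring_1"
  assumes "w \<in> tnodes T"
  shows "\<exists>\<rho> H. \<rho> \<in> leaves_below w \<and>
    (\<forall>v\<in>leaves_below w. (v, \<rho>) \<in> {(x, H x) |x. x \<in> leaves_below w - {\<rho>}}\<^sup>*) \<and>
    (\<forall>r. (\<forall>v\<in>leaves_below w. r v = adjacency_row E X v) \<longrightarrow>
      forest_sum V r = subtree_factor X w *
        forest_sum V (\<lambda>v. if v \<in> leaves_below w - {\<rho>} then forced (H v) else r v))"
  using wf_parent assms
proof (induction w rule: wf_induct_rule)
  case (less w)
  let ?L = leaves_below and ?C = "tree_children T w"
  show ?case
  proof (cases "w \<in> V")
    case True
    thus ?thesis by (simp add: leaves_below_leaf interior_below_leaf subtree_factor_def)
  next
    case False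
    hence w: "w \<in> interior_nodes T" using less.prems leaf_or_interior by blast
    have "\<forall>c\<in>?C. \<exists>p. fst p \<in> ?L c \<and>
      (\<forall>v\<in>?L c. (v, fst p) \<in> {(x, snd p x) |x. x \<in> ?L c - {fst p}}\<^sup>*) \<and>
      (\<forall>r. (\<forall>v\<in>?L c. r v = adjacency_row E X v) \<longrightarrow>
        forest_sum V r = subtree_factor X c *
          forest_sum V (\<lambda>v. if v \<in> ?L c - {fst p} then forced (snd p v) else r v))"
      (is "\<forall>c\<in>?C. ?goal c")
    proof
      fix c assume c: "c \<in> ?C"
      hence "(c, w) \<in> parent_rel T" "c \<in> tnodes T"
        using children_nodes by (auto simp: tree_children_def)
      from less.IH[OF this] obtain \<rho> H where "\<rho> \<in> ?L c \<and>
        (\<forall>v\<in>?L c. (v, \<rho>) \<in> {(x, H x) |x. x \<in> ?L c - {\<rho>}}\<^sup>*) \<and>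
        (\<forall>r. (\<forall>v\<in>?L c. r v = adjacency_row E X v) \<longrightarrow>
          forest_sum V r = subtree_factor X c *
            forest_sum V (\<lambda>v. if v \<in> ?L c - {\<rho>} then forced (H v) else r v))"
        by (elim exE)
      thus "?goal c" by (intro exI[of _ "(\<rho>, H)"], unfold fst_conv snd_conv)
    qed
    then obtain p where p: "\<forall>c\<in>?C. fst (p c) \<in> ?L c \<and>
      (\<forall>v\<in>?L c. (v, fst (p c)) \<in> {(x, snd (p c) x) |x. x \<in> ?L c - {fst (p c)}}\<^sup>*) \<and>
      (\<forall>r. (\<forall>v\<in>?L c. r v = adjacency_row E X v) \<longrightarrow>
        forest_sum V r = subtree_factor X c *
          forest_sum V (\<lambda>v. if v \<in> ?L c - {fst (p c)} then forced (snd (p c) v) else r v))"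
      by (rule bchoice[THEN exE])
    define \<rho> where "\<rho> c = fst (p c)" for c
    \<comment> \<open>Each leaf below \<open>w\<close> is below exactly one child, so the maps of
      the children merge into a single \<open>H\<close>.\<close>
    define child where "child v = (THE c. c \<in> ?C \<and> v \<in> ?L c)" for v
    define H where "H v = snd (p (child v)) v" for v
    have child: "child v = c" if "c \<in> ?C" "v \<in> ?L c" for v c
      unfolding child_def using that children_below_disjoint
      by (intro the_equality) (auto simp: leaves_below_def)
    have H: "H v = snd (p c) v" if "c \<in> ?C" "v \<in> ?L c" for v c
      using child[OF that] by (simp add: H_def)
    have \<rho>: "\<rho> c \<in> ?L c" if "c \<in> ?C" for c using p that by (simp add: \<rho>_def)
    have reach: "(v, \<rho> c) \<in> {(x, H x) |x. x \<in> ?L c - {\<rho> c}}\<^sup>*"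
      if "c \<in> ?C" "v \<in> ?L c" for c v
    proof -
      have "{(x, snd (p c) x) |x. x \<in> ?L c - {\<rho> c}} = {(x, H x) |x. x \<in> ?L c - {\<rho> c}}"
        using H that(1) by auto
      moreover have "(v, \<rho> c) \<in> {(x, snd (p c) x) |x. x \<in> ?L c - {\<rho> c}}\<^sup>*"
        using bspec[OF p that(1)] that(2) unfolding \<rho>_def by blast
      ultimately show ?thesis by (simp only:)
    qed
    have collapse: "forest_sum V r = subtree_factor X c *
        forest_sum V (\<lambda>v. if v \<in> ?L c - {\<rho> c} then forced (H v) else r v)"
      if "c \<in> ?C" "\<forall>v\<in>?L c. r v = adjacency_row E X v" for c r
    proof -
      have "(\<lambda>v. if v \<in> ?L c - {\<rho> c} then forced (snd (p c) v) else r v) =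
          (\<lambda>v. if v \<in> ?L c - {\<rho> c} then forced (H v) else r v)"
        using H that(1) by (auto simp: fun_eq_iff)
      moreover have "forest_sum V r = subtree_factor X c *
          forest_sum V (\<lambda>v. if v \<in> ?L c - {\<rho> c} then forced (snd (p c) v) else r v)"
        using bspec[OF p that(1)] that(2) unfolding \<rho>_def by blast
      ultimately show ?thesis by (simp only:)
    qed
    have inj: "inj_on \<rho> ?C" using \<rho> child by (metis inj_onI)
    \<comment> \<open>The representative of an arbitrary child \<open>c0\<close> becomes that of
      \<open>w\<close>; the other representatives, collected in \<open>K\<close>, will be forced to
      it.\<close>
    obtain c0 where c0: "c0 \<in> ?C"
      using w by (auto simp: interior_nodes_def tree_leaves_def)
    define D where "D = (\<Union>c\<in>?C. ?L c - {\<rho> c})"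
    define K where "K = \<rho> ` ?C - {\<rho> c0}"
    define H' where "H' v = (if v \<in> K then \<rho> c0 else H v)" for v
    have Lw: "?L w = (\<Union>c\<in>?C. ?L c)" using leaves_below_interior[OF w] .
    have LV: "?L c \<subseteq> V" for c by (auto simp: leaves_below_def)
    have \<rho>D: "\<rho> c \<notin> D" if "c \<in> ?C" for c
    proof
      assume "\<rho> c \<in> D"
      then obtain d where d: "d \<in> ?C" "\<rho> c \<in> ?L d" "\<rho> c \<noteq> \<rho> d" by (auto simp: D_def)
      thus False using child[OF that \<rho>[OF that]] child[OF d(1,2)] by simp
    qed
    have Lw_split: "?L w - {\<rho> c0} = D \<union> K"
      using \<rho> \<rho>D c0 unfolding Lw D_def K_def by blast
    have reachD: "(v, \<rho> c) \<in> {(x, H x) |x. x \<in> D}\<^sup>*" if "c \<in> ?C" "v \<in> ?L c" for c v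
      using reach[OF that] by (rule rtrancl_mono[THEN subsetD, rotated]) (use that D_def in auto)
    have reachw: "(v, \<rho> c0) \<in> {(x, H' x) |x. x \<in> ?L w - {\<rho> c0}}\<^sup>*" if v: "v \<in> ?L w" for v
    proof -
      obtain c where c: "c \<in> ?C" "v \<in> ?L c" using v Lw by auto
      have "{(x, H x) |x. x \<in> D} \<subseteq> {(x, H' x) |x. x \<in> ?L w - {\<rho> c0}}"
        using \<rho>D by (auto simp: Lw_split H'_def K_def)
      hence "(v, \<rho> c) \<in> {(x, H' x) |x. x \<in> ?L w - {\<rho> c0}}\<^sup>*"
        using reachD[OF c] rtrancl_mono by blast
      moreover have "(\<rho> c, \<rho> c0) \<in> {(x, H' x) |x. x \<in> ?L w - {\<rho> c0}}\<^sup>*"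
      proof (cases "\<rho> c = \<rho> c0")
        case False
        hence "\<rho> c \<in> K" using c by (auto simp: K_def)
        hence "(\<rho> c, \<rho> c0) \<in> {(x, H' x) |x. x \<in> ?L w - {\<rho> c0}}"
          unfolding Lw_split by (auto simp: H'_def)
        thus ?thesis by (rule r_into_rtrancl)
      qed simp
      ultimately show ?thesis by (rule rtrancl_trans)
    qed
    have "forest_sum V r = subtree_factor X w *
        forest_sum V (\<lambda>v. if v \<in> ?L w - {\<rho> c0} then forced (H' v) else r v)"
      if r: "\<forall>v\<in>?L w. r v = adjacency_row E X v" for r
    proof -
      let ?r1 = "\<lambda>v. if v \<in> D then forced (H v) else r v"
      let ?r2 = "\<lambda>v. if v \<in> D then forced (H v) else if v \<in> \<rho> ` ?C then link_row T X w else r v"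
      let ?r3 = "\<lambda>v. if v \<in> K then forced (\<rho> c0) else ?r2 v"
      let ?r4 = "\<lambda>v. if v \<in> ?L w - {\<rho> c0} then forced (H' v) else r v"
      have "forest_sum V r = (\<Prod>c\<in>?C. subtree_factor X c) * forest_sum V ?r1"
        unfolding D_def using r Lw by (intro forest_sum_collapse_children[OF subset_refl collapse]) auto
      \<comment> \<open>Targets below \<open>c\<close> lead to \<open>\<rho> c\<close> along forced
        arcs, so the entries there may be changed; at all other targets the two rows agree
        already.\<close>
      also have "forest_sum V ?r1 = forest_sum V ?r2"
      proof (rule forest_sum_cong_back_arcs[where D = D and H = H])
        fix v y assume v: "v \<in> V" "v \<notin> D" "y \<in> targets V"
        show "?r1 v y = ?r2 v y \<or> (\<exists>z. y = Some z \<and> (z, v) \<in> {(x, H x) |x. x \<in> D}\<^sup>*)"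
        proof (cases "v \<in> \<rho> ` ?C")
          case True
          then obtain c where c: "c \<in> ?C" "v = \<rho> c" by auto
          show ?thesis
          proof (cases "y \<in> Some ` ?L c")
            case True
            thus ?thesis using reachD[OF c(1)] c(2) by auto
          next
            case False
            have "r v = adjacency_row E X v" using r Lw c \<rho> by auto
            thus ?thesis
              using adjacency_row_eq_link_row[OF c(1) \<rho>[OF c(1)] v(3) False] v(2) c by auto
          qed
        qed simp
      qed (use finite_V LV in \<open>auto simp: D_def\<close>)
      \<comment> \<open>The representatives are now twins: all but one are forced, each contributing
        the total of \<open>link_row\<close>.\<close>
      also have "\<dots> = sum (?r2 (\<rho> c0)) (targets V) ^ card K * forest_sum V ?r3"
        by (rule forest_sum_twin_class) (use finite_V LV \<rho> \<rho>D c0 in \<open>auto simp: K_def\<close>)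
      also have "?r2 (\<rho> c0) = link_row T X w" using \<rho>D c0 by auto
      also have "card K = card ?C - 1"
        using c0 finite_children by (simp add: K_def card_image[OF inj])
      \<comment> \<open>The replacement is undone at \<open>\<rho> c0\<close>, so that the induction
        can continue at the parent of \<open>w\<close>. By now every target below \<open>w\<close>
        leads to \<open>\<rho> c0\<close>.\<close>
      also have "forest_sum V ?r3 = forest_sum V ?r4"
      proof (rule forest_sum_cong_back_arcs[where D = "?L w - {\<rho> c0}" and H = H'])
        fix v y assume v: "v \<in> V" "v \<notin> ?L w - {\<rho> c0}" "y \<in> targets V"
        show "?r3 v y = ?r4 v y \<or>
          (\<exists>z. y = Some z \<and> (z, v) \<in> {(x, H' x) |x. x \<in> ?L w - {\<rho> c0}}\<^sup>*)"
        proof (cases "v = \<rho> c0")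
          case True
          show ?thesis
          proof (cases "y \<in> Some ` ?L w")
            case True
            thus ?thesis using reachw \<open>v = \<rho> c0\<close> by auto
          next
            case False
            have "r v = adjacency_row E X v" using r Lw c0 \<rho> True by auto
            moreover have "y \<notin> Some ` ?L c0" using False Lw c0 by auto
            ultimately show ?thesis
              using adjacency_row_eq_link_row[OF c0 \<rho>[OF c0] v(3), of X] True \<rho>D[OF c0] c0
              by (auto simp: K_def)
          qed
        next
          case False
          hence "v \<notin> D" "v \<notin> K" "v \<notin> \<rho> ` ?C"
            using v(2) Lw_split by (auto simp: K_def)
          hence "?r3 v = ?r4 v" using v(2) by auto
          thus ?thesis by simp
        qed
      next
        fix v assume "v \<in> ?L w - {\<rho> c0}"
        thus "?r3 v = forced (H' v)" unfolding Lw_split by (auto simp: H'_def)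
      qed (use finite_V LV in auto)
      finally show ?thesis
        by (simp add: subtree_factor_interior[OF w] sum_link_row ac_simps)
    qed
    moreover have "\<rho> c0 \<in> ?L w" using \<rho> c0 Lw by auto
    ultimately show ?thesis using reachw by blast
  qed
qed

section \<open>Evaluation at the root of the cotree\<close>

lemma leaves_below_root: "leaves_below (troot T) = V"
  using below_root V_subset_nodes by (auto simp: leaves_below_def)

lemma interior_below_root: "interior_below (troot T) = interior_nodes T"
  using below_root by (auto simp: interior_below_def interior_nodes_def)

text \<open>At the root of the cotree every leaf but one is forced, and the sole surviving forest
  has that leaf as its root, with weight \<open>X\<close>.\<close>

lemma forest_sum_adjacency_row:
  "forest_sum V (adjacency_row E X) = X *
    (\<Prod>z\<in>interior_nodes T. (X + of_nat (interior_degree T z)) ^ (card (tree_children T z) - 1))"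
proof -
  let ?w = "troot T"
  have root: "?w \<in> tnodes T" using rooted by (simp add: rooted_tree_def)
  from forest_sum_collapse[OF root, of X, unfolded leaves_below_root] obtain \<rho> H where \<rho>: "\<rho> \<in> V"
    and reach: "\<forall>v\<in>V. (v, \<rho>) \<in> {(x, H x) |x. x \<in> V - {\<rho>}}\<^sup>*"
    and eq: "\<forall>r. (\<forall>v\<in>V. r v = adjacency_row E X v) \<longrightarrow> forest_sum V r = subtree_factor X ?w *
        forest_sum V (\<lambda>v. if v \<in> V - {\<rho>} then forced (H v) else r v)"
    by (elim exE conjE)
  have "forest_sum V (\<lambda>v. if v \<in> V - {\<rho>} then forced (H v) else adjacency_row E X v) = X"
    by (subst forest_sum_all_forced[OF finite_V \<rho> _ reach[rule_format]]) (simp_all add: adjacency_row_def)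
  thus ?thesis
    using eq[rule_format, of "adjacency_row E X", OF refl]
    by (simp add: subtree_factor_def interior_below_root mult.commute)
qed

lemma interior_degree_root:
  assumes "troot T \<in> interior_nodes T" "tlabel T (troot T) = JoinNode"
  shows "interior_degree T (troot T) = card V"
proof -
  have "tlabel T (lca T (tparent T v) (troot T)) = JoinNode" if "v \<in> V" for v
  proof -
    have "v \<noteq> troot T" using that assms leaves by (auto simp: interior_nodes_def)
    hence "(tparent T v, troot T) \<in> below"
      using parent_below(2) below_root that V_subset_nodes by blast
    thus ?thesis using assms lca_ancestor by simp
  qed
  hence "{v \<in> V. tlabel T (lca T (tparent T v) (troot T)) = JoinNode} = V" by blast
  thus ?thesis by (simp add: interior_degree_def leaves)
qed

lemma card_children:
  "num_interior_children T w + num_leaf_children T w = card (tree_children T w)"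
proof -
  have "tree_children T w =
      (tree_children T w \<inter> interior_nodes T) \<union> (tree_children T w \<inter> tree_leaves T)"
    using children_nodes by (auto simp: interior_nodes_def)
  moreover have "(tree_children T w \<inter> interior_nodes T) \<inter> (tree_children T w \<inter> tree_leaves T) = {}"
    by (auto simp: interior_nodes_def)
  ultimately show ?thesis
    unfolding num_interior_children_def num_leaf_children_def
    by (metis card_Un_disjoint finite_Int finite_children)
qed

end

section \<open>From the polynomial to the product formula\<close>

theorem theorem4p1:
  fixes V :: "'a set" and E :: "'a set set" and T :: "'a cotree"
    and w :: "nat \<Rightarrow> 'a" and s t :: "nat \<Rightarrow> nat" and n r :: nat
  assumes "cograph V E" and "connected_graph V E" and "card V = n"
    and "is_cotree_of T V E"
    and "bij_betw w {1..r} (interior_nodes T)" and "w 1 = troot T"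
    and "\<And>i. i \<in> {1..r} \<Longrightarrow> s i = num_interior_children T (w i)"
    and "\<And>i. i \<in> {1..r} \<Longrightarrow> t i = num_leaf_children T (w i)"
  shows "card (spanning_trees V E) =
    (\<Prod>i = 2..r. interior_degree T (w i) ^ (s i + t i - 1)) * n ^ (s 1 + t 1 - 2)"
proof -
  have graph: "simple_graph V E" using assms(1) by (simp add: cograph_def)
  interpret labelled_cotree T V E
    using assms(4) by unfold_locales (auto simp: is_cotree_of_def)
  let ?Q = "\<Prod>z\<in>interior_nodes T. interior_degree T z ^ (card (tree_children T z) - 1)"
  have "n * card (spanning_trees V E) = coeff (forest_sum V (adjacency_row E [:0, 1::nat:])) 1"
    using coeff_forest_sum[OF graph] assms(3) by simp
  \<comment> \<open>The factor \<open>[:0, 1:]\<close> shifts coefficients, so the coefficient of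
    index 1 is the constant term of the remaining product.\<close>
  also have "\<dots> = poly (\<Prod>z\<in>interior_nodes T.
      ([:0, 1::nat:] + of_nat (interior_degree T z)) ^ (card (tree_children T z) - 1)) 0"
    unfolding forest_sum_adjacency_row by (simp add: coeff_pCons poly_0_coeff_0)
  also have "\<dots> = ?Q"
    by (simp add: poly_prod)
  finally have count: "n * card (spanning_trees V E) = ?Q" .
  show ?thesis
  \<comment> \<open>If the root is a leaf, the graph has one vertex and \<open>r = 0\<close>. Then
    \<open>s 1\<close> and \<open>t 1\<close> may be anything, but the base \<open>n\<close> is
    1.\<close>
  proof (cases "troot T \<in> V")
    case True
    have "V = {troot T}" "interior_nodes T = {}"
      using leaves_below_leaf[OF True] interior_below_leaf[OF True]
      by (simp_all add: leaves_below_root interior_below_root)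
    moreover from this have "r = 0" using assms(5) by (auto simp: bij_betw_def)
    ultimately show ?thesis using count assms(3) by simp
  next
    case False
    have root: "troot T \<in> interior_nodes T"
      using False leaf_or_interior rooted by (auto simp: rooted_tree_def)
    hence "{1..r} \<noteq> {}" using assms(5) by (auto simp: bij_betw_def)
    hence split: "{1..r} = insert 1 {2..r}" by auto
    hence one: "1 \<in> {1..r}" by blast
    have st: "s i + t i = card (tree_children T (w i))" if "i \<in> {1..r}" for i
      using assms(7,8)[OF that] card_children by simp
    \<comment> \<open>Connectedness makes the root a join node.\<close>
    have deg: "interior_degree T (w 1) = n"
      using interior_degree_root[OF root] assms(2-4,6) root by (simp add: is_cotree_of_def)
    have "2 \<le> card (tree_children T (troot T))"
      using assms(4) root by (simp add: is_cotree_of_def)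
    hence "2 \<le> s 1 + t 1" using st[OF one] assms(6) by simp
    \<comment> \<open>The root has at least two children, so the subtractions in its exponents are
      exact: its factor is \<open>n ^ Suc k\<close>, and one \<open>n\<close> cancels against the
      choice of a root of the spanning tree.\<close>
    then obtain k where k: "s 1 + t 1 = Suc (Suc k)" by (metis add_2_eq_Suc le_Suc_ex)
    have "n * card (spanning_trees V E) = (\<Prod>i = 1..r. interior_degree T (w i) ^ (s i + t i - 1))"
      unfolding count using st by (simp add: prod.reindex_bij_betw[OF assms(5), symmetric])
    also have "\<dots> = n * (n ^ k * (\<Prod>i = 2..r. interior_degree T (w i) ^ (s i + t i - 1)))"
      unfolding split using k deg by simp
    finally have "card (spanning_trees V E) =
        n ^ k * (\<Prod>i = 2..r. interior_degree T (w i) ^ (s i + t i - 1))"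
      using assms(2,3) finite_V by (auto simp: connected_graph_def)
    moreover have "s 1 + t 1 - 2 = k" using k by simp
    ultimately show ?thesis by (simp only: mult.commute)
  qed
qed

end
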